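(* If $k\ge 4$ is an integer, then there is no graph $G$ with $\omega(G)=2$, $\chi(G)=k$ and $\chi_{\rho}(G)=k+1$; that is, the triple $(2,k,k+1)$ is not realizable.
   Context: All graphs are finite and simple. $\omega(G)$ is the clique number and $\chi(G)$ the chromatic number of $G$. For a positive integer $i$, an $i$-packing in $G$ is a set $W\subseteq V(G)$ such that any two distinct vertices of $W$ are at distance greater than $i$ in $G$. The packing chromatic number $\chi_{\rho}(G)$ is the smallest integer $k$ such that $V(G)$ can be partitioned into sets $V_1,\dots,V_k$ with $V_i$ an $i$-packing for each $i\in\{1,\dots,k\}$. A triple $(a,b,c)$ is realizable if some graph $G$ has $\omega(G)=a$, $\chi(G)=b$, $\chi_{\rho}(G)=c$. *)

theory Defs
  imports "Graph_Theory.Graph_Theory" "HOL-Library.Disjoint_Sets"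
begin

text \<open>
  A finite simple graph is a \<^locale>\<open>pair_graph\<close>: a finite vertex set with a finite, symmetric,
  irreflexive arc relation, each edge being represented by its two opposite arcs.
\<close>

definition is_clique :: "'a pair_pre_digraph \<Rightarrow> 'a set \<Rightarrow> bool" where
  "is_clique G S \<longleftrightarrow>
     S \<subseteq> pverts G \<and> (\<forall>u\<in>S. \<forall>v\<in>S. u \<noteq> v \<longrightarrow> (u, v) \<in> parcs G)"

definition clique_number :: "'a pair_pre_digraph \<Rightarrow> nat" where
  "clique_number G = Max {card S | S. is_clique G S}"

definition proper_colouring :: "'a pair_pre_digraph \<Rightarrow> nat \<Rightarrow> ('a \<Rightarrow> nat) \<Rightarrow> bool" where
  "proper_colouring G k f \<longleftrightarrow>
     f ` pverts G \<subseteq> {1..k} \<and> (\<forall>(u, v) \<in> parcs G. f u \<noteq> f v)"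

definition chromatic_number :: "'a pair_pre_digraph \<Rightarrow> nat" where
  "chromatic_number G = (LEAST k. \<exists>f. proper_colouring G k f)"

text \<open>
  With unit arc weights the cost of a walk is its length; the distance between vertices of
  different components is \<open>\<infinity>\<close>.
\<close>

definition graph_dist :: "'a pair_pre_digraph \<Rightarrow> 'a \<Rightarrow> 'a \<Rightarrow> ereal" where
  "graph_dist G u v = wf_digraph.\<mu> (with_proj G) (\<lambda>_. 1) u v"

lemma graph_dist_eq_INF_length:
  assumes "pair_graph G"
  shows "graph_dist G u v =
    (INF p \<in> {p. pre_digraph.awalk (with_proj G) u p v}. ereal (length p))"
proof -
  interpret pair_graph G by fact
  have "awalk_cost (\<lambda>_. 1) p = length p" for p
    by (induct p) auto
  then show ?thesis
    by (simp add: graph_dist_def \<mu>_def)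
qed

definition packing :: "'a pair_pre_digraph \<Rightarrow> nat \<Rightarrow> 'a set \<Rightarrow> bool" where
  "packing G i W \<longleftrightarrow>
     W \<subseteq> pverts G \<and> (\<forall>u\<in>W. \<forall>v\<in>W. u \<noteq> v \<longrightarrow> graph_dist G u v > ereal (real i))"

text \<open>
  Classes may be empty. This does not affect the minimum: in a partition with the fewest
  classes none is empty, since \<open>V k\<close> could otherwise replace an empty \<open>V i\<close> with \<open>i < k\<close>.
\<close>

definition packing_partition :: "'a pair_pre_digraph \<Rightarrow> nat \<Rightarrow> (nat \<Rightarrow> 'a set) \<Rightarrow> bool" where
  "packing_partition G k V \<longleftrightarrow>
     (\<Union>i\<in>{1..k}. V i) = pverts G \<and> disjoint_family_on V {1..k} \<and>
     (\<forall>i\<in>{1..k}. packing G i (V i))"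

definition packing_chromatic_number :: "'a pair_pre_digraph \<Rightarrow> nat" where
  "packing_chromatic_number G = (LEAST k. \<exists>V. packing_partition G k V)"

end

theory Submission
  imports Defs "HOL-Number_Theory.Cong"
begin

text \<open>
  Let \<open>V\<^sub>1, \<dots>, V\<^bsub>k+1\<^esub>\<close> be a packing colouring. A shortest odd closed walk inside
  \<open>V\<^sub>2 \<union> V\<^sub>3 \<union> V\<^sub>4 \<union> V\<^sub>5\<close> would be a cycle of some odd length \<open>n \<ge> 5\<close>, as there are no
  triangles. The vertices of \<open>V\<^sub>i\<close> are pairwise more than \<open>i\<close> apart on it, so there are at most
  \<open>n / (i + 1)\<close> of them (or just one, if \<open>n \<le> i\<close>). For \<open>n = 5\<close> this gives at most 4 vertices, and
  for \<open>n \<ge> 7\<close> at most \<open>(1/3 + 1/4 + 1/5 + 1/6) n = 19/20 n\<close>, both less than \<open>n\<close>. Hence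
  these four classes induce a bipartite graph and can be recoloured with two colours, so that
  \<open>k - 1\<close> colours suffice for the whole graph.
\<close>

section \<open>Odd closed walks and bipartiteness\<close>

lemma sym_relpow: "sym R \<Longrightarrow> (x, y) \<in> R ^^ n \<Longrightarrow> (y, x) \<in> R ^^ n"
proof (induction n arbitrary: y)
  case (Suc n)
  then obtain z where "(x, z) \<in> R ^^ n" "(z, y) \<in> R"
    by auto
  with Suc have "(y, z) \<in> R" "(z, x) \<in> R ^^ n"
    by (auto dest: symD)
  then show ?case
    by (rule relpow_Suc_I2)
qed auto

text \<open>Colour by the parity of some walk, not necessarily a shortest one, from a root chosen in
  each component: an edge and the walks to its two ends close up at the root.\<close>

lemma bipartite_if_no_odd_closed_walk:
  assumes "sym E" and even: "\<And>x n. (x, x) \<in> E ^^ n \<Longrightarrow> even n"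
  shows "\<exists>f :: 'a \<Rightarrow> bool. \<forall>(x, y) \<in> E. f x \<noteq> f y"
proof -
  define root where "root v = (SOME u. (u, v) \<in> E\<^sup>*)" for v
  define len where "len v = (SOME n. (root v, v) \<in> E ^^ n)" for v
  have "(root v, v) \<in> E\<^sup>*" for v
    unfolding root_def by (rule someI[of _ v]) simp
  then have len: "(root v, v) \<in> E ^^ len v" for v
    unfolding len_def by (meson rtrancl_imp_relpow someI_ex)
  have "even (len x) \<noteq> even (len y)" if xy: "(x, y) \<in> E" for x y
  proof -
    have "(y, x) \<in> E"
      using xy \<open>sym E\<close> by (auto dest: symD)
    \<comment> \<open>\<open>root v\<close> depends only on the set of vertices that reach
      \<open>v\<close>, so ends of an edge share their root.\<close>
    then have "(u, x) \<in> E\<^sup>* \<longleftrightarrow> (u, y) \<in> E\<^sup>*" for u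
      using xy by (meson rtrancl.rtrancl_into_rtrancl)
    then have root: "root x = root y"
      by (simp add: root_def)
    have "(root x, y) \<in> E ^^ Suc (len x)"
      using len[of x] xy by auto
    moreover have "(y, root x) \<in> E ^^ len y"
      using sym_relpow[OF \<open>sym E\<close> len[of y]] root by simp
    ultimately have "(root x, root x) \<in> E ^^ (Suc (len x) + len y)"
      unfolding relpow_add by (rule relcompI)
    from even[OF this] show ?thesis
      by auto
  qed
  then show ?thesis
    by (intro exI[of _ "\<lambda>v. even (len v)"]) auto
qed

text \<open>A repeated vertex would split a shortest odd closed walk into two shorter closed walks,
  one of them odd. The walk \<open>w\<close> is periodic on all naturals, which avoids special cases
  at the wrap-around.\<close>

lemma shortest_odd_closed_walk:
  assumes "(x, x) \<in> E ^^ m" "odd m"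
  obtains n w where "odd n" "\<And>p. (w p, w (Suc p)) \<in> E" "\<And>p. w (p mod n) = w p" "inj_on w {..<n}"
proof -
  define Q where "Q n \<longleftrightarrow> odd n \<and> (\<exists>x. (x, x) \<in> E ^^ n)" for n
  define n where "n = (LEAST n. Q n)"
  have "Q m"
    using assms by (auto simp: Q_def)
  then have "Q n" and min: "\<And>m. Q m \<Longrightarrow> n \<le> m"
    unfolding n_def by (auto intro: LeastI Least_le)
  then obtain v where "odd n" and v: "v n = v 0" "\<And>i. i < n \<Longrightarrow> (v i, v (Suc i)) \<in> E"
    unfolding Q_def relpow_fun_conv by metis
  from \<open>odd n\<close> have "n > 0"
    by (rule odd_pos)
  define w where "w p = v (p mod n)" for p
  have step: "(w p, w (Suc p)) \<in> E" for p
    using v \<open>n > 0\<close> by (metis mod_Suc mod_less_divisor w_def)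
  have walk: "(w p, w (p + d)) \<in> E ^^ d" for p d
    using step by (induction d) auto
  have per: "w (p mod n) = w p" for p
    by (simp add: w_def)
  have "w p \<noteq> w q" if "p < q" "q < n" for p q
  proof
    assume eq: "w p = w q"
    have "(w p, w p) \<in> E ^^ (q - p)"
      using walk[of p "q - p"] eq that by simp
    moreover have "w (p + n) = w p"
      by (simp add: w_def)
    then have "(w p, w p) \<in> E ^^ (n - (q - p))"
      using walk[of q "n - (q - p)"] eq that by (simp add: add.commute)
    moreover have "odd (q - p) \<or> odd (n - (q - p))"
      using \<open>odd n\<close> that by auto
    ultimately have "Q (q - p) \<or> Q (n - (q - p))"
      by (auto simp: Q_def)
    then show False
      using min[of "q - p"] min[of "n - (q - p)"] that by auto
  qed
  then have "inj_on w {..<n}"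
    by (metis inj_onI lessThan_iff linorder_neqE_nat)
  with that \<open>odd n\<close> step per show thesis
    by blast
qed

section \<open>Packing classes on an odd cycle\<close>

text \<open>If \<open>i < n\<close>, the arcs of \<open>i + 1\<close> consecutive positions starting
  at the points of \<open>P\<close> are disjoint. If \<open>n \<le> i\<close>, any two positions are
  within \<open>i\<close> steps of each other.\<close>

lemma card_spread_on_cycle:
  assumes P: "P \<subseteq> {..<n}"
    and spread: "\<And>p q d. p \<in> P \<Longrightarrow> q \<in> P \<Longrightarrow> d \<le> i \<Longrightarrow> p = (q + d) mod n \<Longrightarrow> p = q"
  shows "if n \<le> i then card P \<le> 1 else card P * (i + 1) \<le> n"
proof (cases "n \<le> i")
  case True
  have "p = q" if "p \<in> P" "q \<in> P" for p q
  \<comment> \<open>The witness is the number of forward steps from \<open>q\<close> to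
    \<open>p\<close>; adding \<open>n\<close> first avoids truncated subtraction.\<close>
  proof (rule spread[OF that, of "(n + p - q) mod n"])
    show "(n + p - q) mod n \<le> i"
      using P that True
      by (metis lessThan_iff less_imp_le less_le_trans mod_less_divisor not_less0 not_gr_zero subsetD)
    have "p < n" "q < n"
      using P that by auto
    then show "p = (q + (n + p - q) mod n) mod n"
      by (simp add: mod_add_right_eq)
  qed
  moreover have "finite P"
    using P finite_subset by blast
  ultimately show ?thesis
    using True by (simp add: card_le_Suc0_iff_eq)
next
  case False
  have *: "p = q \<and> j = j'"
    if "p \<in> P" "q \<in> P" "j \<le> j'" "j' \<le> i" "(p + j) mod n = (q + j') mod n" for p q j j'
  proof -
    have "[p + j = (q + (j' - j)) + j] (mod n)"
      using that by (simp add: cong_def)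
    then have c: "[p = q + (j' - j)] (mod n)"
      by (simp only: cong_add_rcancel_nat)
    moreover have "p < n"
      using that P by auto
    ultimately have "p = q"
      using that by (intro spread[of p q "j' - j"]) (auto simp: cong_def)
    with c have "[j' - j = 0] (mod n)"
      using cong_add_lcancel_0_nat cong_sym by blast
    then show ?thesis
      using that False \<open>p = q\<close> by (auto simp: cong_def)
  qed
  have "inj_on (\<lambda>(p, j). (p + j) mod n) (P \<times> {..i})"
  proof -
    have "p = q \<and> j = j'"
      if "p \<in> P" "q \<in> P" "j \<le> i" "j' \<le> i" "(p + j) mod n = (q + j') mod n" for p q j j'
      using *[of p q j j'] *[of q p j' j] that by (cases "j \<le> j'") auto
    then show ?thesis
      by (auto simp: inj_on_def)
  qed
  moreover have "(\<lambda>(p, j). (p + j) mod n) ` (P \<times> {..i}) \<subseteq> {..<n}"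
    using False by auto
  ultimately have "card (P \<times> {..i}) \<le> card {..<n}"
    by (rule card_inj_on_le) simp
  then show ?thesis
    using False by (simp add: card_cartesian_product)
qed

text \<open>Packing is stated through walks in \<open>E\<close>, so that it passes from a graph to
  any subset of its arcs.\<close>

lemma bipartite_if_packing_colours_2_to_5:
  fixes E :: "('a \<times> 'a) set" and c :: "'a \<Rightarrow> nat"
  assumes "sym E" "irrefl E"
    and triangle_free: "\<And>x y z. (x, y) \<in> E \<Longrightarrow> (y, z) \<in> E \<Longrightarrow> (z, x) \<notin> E"
    and range: "\<And>x y. (x, y) \<in> E \<Longrightarrow> c x \<in> {2..5}"
    and packing: "\<And>x y d. (x, y) \<in> E ^^ d \<Longrightarrow> d \<le> c x \<Longrightarrow> c x = c y \<Longrightarrow> x = y"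
  shows "\<exists>f :: 'a \<Rightarrow> bool. \<forall>(x, y) \<in> E. f x \<noteq> f y"
proof (rule bipartite_if_no_odd_closed_walk[OF \<open>sym E\<close>], rule ccontr)
  fix x m
  assume "(x, x) \<in> E ^^ m" "odd m"
  then obtain n w where "odd n" and step: "\<And>p. (w p, w (Suc p)) \<in> E"
    and per: "\<And>p. w (p mod n) = w p" and inj: "inj_on w {..<n}"
    using shortest_odd_closed_walk[of x m E] by metis
  have walk: "(w p, w (p + d)) \<in> E ^^ d" for p d
    using step by (induction d) auto
  have "n \<noteq> 1"
    using step[of 0] per[of 1] \<open>irrefl E\<close> by (auto simp: irrefl_def)
  moreover have "n \<noteq> 3"
    using step[of 0] step[of 1] step[of 2] per[of 3] triangle_free[of "w 0" "w 1" "w 2"]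
    by (auto simp: numeral_eq_Suc)
  moreover have "n \<noteq> 2" "n \<noteq> 4" "n \<noteq> 6" "n \<noteq> 0"
    using \<open>odd n\<close> by (auto dest: odd_pos)
  ultimately have n: "n = 5 \<or> n \<ge> 7"
    by linarith
  \<comment> \<open>Positions are counted instead of vertices; \<open>inj\<close> makes them
    correspond.\<close>
  define P where "P i = {p \<in> {..<n}. c (w p) = i}" for i
  have card_P: "if n \<le> i then card (P i) \<le> 1 else card (P i) * (i + 1) \<le> n" for i
  proof (rule card_spread_on_cycle)
    fix p q d
    assume pq: "p \<in> P i" "q \<in> P i" "d \<le> i" "p = (q + d) mod n"
    then have "(w q, w p) \<in> E ^^ d"
      using walk[of q d] per by simp
    then have "w q = w p"
      using packing pq by (auto simp: P_def)
    then show "p = q"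
      using inj pq by (auto simp: P_def dest: inj_onD)
  qed (auto simp: P_def)
  have "{..<n} = (\<Union>i\<in>{2..5}. P i)"
    using range[OF step] by (auto simp: P_def)
  then have "n = card (\<Union>i\<in>{2..5}. P i)"
    by (metis card_lessThan)
  also have "\<dots> = (\<Sum>i\<in>{2..5}. card (P i))"
    by (rule card_UN_disjoint) (auto simp: P_def)
  also have "\<dots> = card (P 2) + card (P 3) + card (P 4) + card (P 5)"
    by (simp add: numeral_eq_Suc)
  \<comment> \<open>The case \<open>n \<le> i\<close> of \<open>card_P\<close> occurs only for
    \<open>n = i = 5\<close>.\<close>
  finally show False
    using n card_P[of 2] card_P[of 3] card_P[of 4] card_P[of 5]
    by (auto split: if_splits)
qed

section \<open>From graphs to relations\<close>

text \<open>A relational walk yields an arc walk of equal length. For \<open>d = 0\<close> this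
  requires \<open>u\<close> to be a vertex.\<close>

lemma graph_dist_le_relpow:
  assumes "pair_graph G" "u \<in> pverts G" "(u, v) \<in> parcs G ^^ d"
  shows "graph_dist G u v \<le> ereal (real d)"
proof -
  interpret pair_graph G by fact
  have "\<exists>p. awalk u p v \<and> length p = d"
    using assms(3)
  proof (induction d arbitrary: v)
    case 0
    then show ?case
      using assms(2) by (auto simp: awalk_Nil_iff)
  next
    case (Suc d)
    then obtain y where "(u, y) \<in> parcs G ^^ d" and yv: "(y, v) \<in> parcs G"
      by auto
    with Suc.IH obtain p where p: "awalk u p y" "length p = d"
      by blast
    have "awalk y [(y, v)] v"
      using arc_implies_awalk[of "(y, v)"] yv by simp
    then have "awalk u (p @ [(y, v)]) v"
      using p by auto
    then show ?case
      using p by (intro exI[of _ "p @ [(y, v)]"]) simp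
  qed
  then show ?thesis
    unfolding graph_dist_eq_INF_length[OF assms(1)] by (auto intro: INF_lower)
qed

lemma triangle_free_if_clique_number_2:
  assumes "pair_graph G" "clique_number G = 2" "(x, y) \<in> parcs G" "(y, z) \<in> parcs G"
  shows "(z, x) \<notin> parcs G"
proof
  assume zx: "(z, x) \<in> parcs G"
  interpret pair_graph G by fact
  have "finite {card S | S. is_clique G S}"
    by (rule finite_subset[of _ "card ` Pow (pverts G)"]) (auto simp: is_clique_def)
  moreover have "is_clique G {x, y, z}"
    using assms zx arcs_symmetric in_arcsD1 unfolding is_clique_def by auto
  ultimately have "card {x, y, z} \<le> clique_number G"
    unfolding clique_number_def by (intro Max_ge) auto
  moreover have "x \<noteq> y" "y \<noteq> z" "z \<noteq> x"
    using assms zx no_loops' by auto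
  ultimately show False
    using assms(2) by simp
qed

text \<open>Singleton classes always work; hence the \<open>LEAST\<close> in
  \<open>packing_chromatic_number\<close> is attained.\<close>

lemma packing_partition_exists:
  assumes "pair_graph G"
  shows "\<exists>n V. packing_partition G n V"
proof -
  interpret pair_graph G by fact
  obtain h where h: "bij_betw h {1..card (pverts G)} (pverts G)"
    using ex_bij_betw_nat_finite_1[OF pair_finite_verts] by blast
  have "(\<Union>i\<in>{1..card (pverts G)}. {h i}) = pverts G"
    using bij_betw_imp_surj_on[OF h] by blast
  moreover have "disjoint_family_on (\<lambda>i. {h i}) {1..card (pverts G)}"
    using inj_onD[OF bij_betw_imp_inj_on[OF h]] by (auto simp: disjoint_family_on_def)
  moreover have "packing G i {h i}" if "i \<in> {1..card (pverts G)}" for i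
    using bij_betwE[OF h] that by (simp add: packing_def)
  ultimately have "packing_partition G (card (pverts G)) (\<lambda>i. {h i})"
    unfolding packing_partition_def by blast
  then show ?thesis
    by blast
qed

lemma proper_colouring_if_packing_partition:
  assumes G: "pair_graph G" "clique_number G = 2"
    and V: "packing_partition G (k + 1) V" and "k \<ge> 4"
  shows "\<exists>f. proper_colouring G (k - 1) f"
proof -
  interpret pair_graph G by fact
  have "\<forall>v\<in>pverts G. \<exists>i\<in>{1..k + 1}. v \<in> V i"
    using V by (auto simp: packing_partition_def)
  then obtain c where c: "\<And>v. v \<in> pverts G \<Longrightarrow> c v \<in> {1..k + 1} \<and> v \<in> V (c v)"
    by metis
  have packing: "x = y"
    if "(x, y) \<in> parcs G ^^ d" "d \<le> c x" "c x = c y" "x \<in> pverts G" "y \<in> pverts G" for x y d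
  proof (rule ccontr)
    assume "x \<noteq> y"
    then have "graph_dist G x y > ereal (real (c x))"
      using V c[of x] c[of y] that unfolding packing_partition_def packing_def by auto
    then have "ereal (real (c x)) < ereal (real d)"
      using graph_dist_le_relpow[OF G(1) that(4,1)] by (rule less_le_trans)
    with that show False
      by simp
  qed
  define E where "E = {(x, y) \<in> parcs G. c x \<in> {2..5} \<and> c y \<in> {2..5}}"
  have E: "(x, y) \<in> parcs G ^^ d" if "(x, y) \<in> E ^^ d" for x y d
    using that by (induction d arbitrary: y) (auto simp: E_def)
  \<comment> \<open>The first alternative covers walks of length 0, which exist even at points
    outside the graph.\<close>
  have end_in: "x = y \<or> x \<in> pverts G \<and> y \<in> pverts G" if "(x, y) \<in> parcs G ^^ d" for x y d
    using that
  proof (induction d arbitrary: y)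
    case (Suc d)
    then obtain z where "(x, z) \<in> parcs G ^^ d" "(z, y) \<in> parcs G"
      by auto
    with Suc.IH show ?case
      using in_arcsD1 in_arcsD2 by blast
  qed auto
  have "\<exists>b :: _ \<Rightarrow> bool. \<forall>(x, y) \<in> E. b x \<noteq> b y"
  proof (rule bipartite_if_packing_colours_2_to_5[of E c])
    show "sym E"
      using arcs_symmetric by (auto simp: E_def sym_def)
    show "irrefl E"
      using no_loops' by (auto simp: E_def irrefl_def)
    show "x = y" if "(x, y) \<in> E ^^ d" "d \<le> c x" "c x = c y" for x y d
      using packing that E end_in by blast
  qed (use triangle_free_if_clique_number_2[OF G] in \<open>auto simp: E_def\<close>)
  then obtain b :: "'a \<Rightarrow> bool" where b: "\<And>x y. (x, y) \<in> E \<Longrightarrow> b x \<noteq> b y"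
    by blast
  \<comment> \<open>Classes 2 to 5 shrink to colours 2 and 3, and classes 6 to \<open>k + 1\<close>
    move down to 4 to \<open>k - 1\<close>.\<close>
  define f where
    "f v = (if c v = 1 then 1 else if c v \<le> 5 then (if b v then 2 else 3) else c v - 2)" for v
  have "f u \<noteq> f v" if uv: "(u, v) \<in> parcs G" for u v
  proof -
    have inV: "u \<in> pverts G" "v \<in> pverts G"
      using uv in_arcsD1 in_arcsD2 by blast+
    then have pos: "c u \<ge> 1" "c v \<ge> 1"
      using c by force+
    have "u \<noteq> v"
      using uv no_loops' by auto
    \<comment> \<open>An arc is a walk of length 1, too short for any class.\<close>
    then have "c u \<noteq> c v"
      using packing[of u v 1] uv inV pos by auto
    moreover have "b u \<noteq> b v" if "c u \<in> {2..5}" "c v \<in> {2..5}"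
      using b[of u v] uv that by (auto simp: E_def)
    ultimately show ?thesis
      using pos unfolding f_def by (auto split: if_splits)
  qed
  moreover have "f v \<in> {1..k - 1}" if "v \<in> pverts G" for v
    using c[OF that] \<open>k \<ge> 4\<close> unfolding f_def by auto
  ultimately have "proper_colouring G (k - 1) f"
    unfolding proper_colouring_def by auto
  then show ?thesis
    by blast
qed

theorem theorem3p4:
  fixes k :: nat
  assumes "k \<ge> 4"
  shows "\<not> (\<exists>G :: 'a pair_pre_digraph. pair_graph G \<and> clique_number G = 2 \<and>
           chromatic_number G = k \<and> packing_chromatic_number G = k + 1)"
proof (rule notI, elim exE conjE)
  fix G :: "'a pair_pre_digraph"
  assume G: "pair_graph G" "clique_number G = 2"
    and chi: "chromatic_number G = k" "packing_chromatic_number G = k + 1"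
  have "\<exists>V. packing_partition G (packing_chromatic_number G) V"
    unfolding packing_chromatic_number_def
    by (rule LeastI_ex) (rule packing_partition_exists[OF G(1)])
  then obtain f where "proper_colouring G (k - 1) f"
    using proper_colouring_if_packing_partition[OF G _ assms] unfolding chi(2) by blast
  then have "chromatic_number G \<le> k - 1"
    unfolding chromatic_number_def by (intro Least_le) blast
  with chi assms show False
    by linarith
qed

end
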